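(* Let $k,n$ be non-negative integers and let $p_1,\dots,p_{k+1}$ be primes (not necessarily distinct) with each $p_i\equiv 3\pmod 4$. Then for every integer $j$ not divisible by $p_{k+1}$, $$\mathcal{J}_{10}\Big(p_1^2p_2^2\cdots p_k^2\,p_{k+1}\,\big(4p_{k+1}n+4j+p_{k+1}\big)\Big)\equiv 0\pmod 2.$$
   Context: Let $q=e^{2\pi i\tau}$, $(a;q)_\infty=\prod_{j\ge0}(1-aq^j)$, and $\eta(\tau)=q^{1/24}(q;q)_\infty$. Define $$j_{10}(\tau)=\frac{\eta(2\tau)\eta(5\tau)^5}{\eta(\tau)\eta(10\tau)^5}-1=\frac1q+\sum_{n\ge0}\mathcal{J}_{10}(n)q^n.$$ *)

theory Defs
  imports "HOL-Computational_Algebra.Formal_Power_Series"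
begin

text \<open>(q^m;q^m)_infinity as a formal power series in q (m >= 1): its n-th coefficient
  equals the n-th coefficient of the finite product of (1 - q^(m i)) for i = 1..n.\<close>
definition euler_fps :: "nat \<Rightarrow> rat fps" where
  "euler_fps m = Abs_fps (\<lambda>n. fps_nth (\<Prod>i\<in>{1..n}. (1 - fps_X ^ (m * i))) n)"

text \<open>q * (eta(2t) eta(5t)^5 / (eta(t) eta(10t)^5)) as a power series in q.\<close>
definition j10_series :: "rat fps" where
  "j10_series = euler_fps 2 * euler_fps 5 ^ 5 * inverse (euler_fps 1 * euler_fps 10 ^ 5)"

text \<open>j10 = 1/q + sum_{n>=0} J10(n) q^n, with j10 = (eta quotient) - 1.\<close>
definition J10 :: "nat \<Rightarrow> rat" where
  "J10 n = fps_nth j10_series (n + 1) - (if n = 0 then 1 else 0)"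

end

theory Submission
  imports Defs "HOL-Library.Z2" "HOL-Computational_Algebra.Primes"
begin

text \<open>
  Work modulo 2 and write A, B for the Euler products at q and q^5. The Jacobi triple product
  turns A B into the product of the theta series with exponents (5x^2 - 3x)/2 and (5y^2 - y)/2,
  so its m-th coefficient counts representations 4m + 1 = u^2 + v^2 in one residue class of
  u + 3v mod 5. Multiplication by i in the Gaussian integers permutes the nonzero classes, and
  conjugation shows that this count is odd exactly if 4m + 1 is a square or 5 times a square.
  Comparing with the theta series of A^3 and B^3 gives A B = A^6 + q B^6. Since
  q (j10 + 1) = A / B^5 = (A^3 / B^3)^2 + q and A^3 / B^3 = (A^4 / B^2)^2 + q (A B)^2,
  J10 (4m + 1) has the parity of the m-th coefficient of A B. The index in the theorem is
  1 mod 4 and has an odd p_(k+1)-adic valuation with p_(k+1) different from 5.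
\<close>

subsection \<open>The Jacobi triple product for formal power series\<close>

text \<open>Congruence modulo \<open>fps_X ^ N\<close>. Identities between infinite products are
  proved for every \<open>N\<close> on finite truncations, so no limits occur.\<close>

definition fps_cong :: "nat \<Rightarrow> 'a::comm_ring_1 fps \<Rightarrow> 'a fps \<Rightarrow> bool" where
  "fps_cong N f g \<longleftrightarrow> (\<forall>m<N. fps_nth f m = fps_nth g m)"

lemma fps_cong_refl [simp]: "fps_cong N f f"
  by (simp add: fps_cong_def)

lemma fps_cong_sym: "fps_cong N f g \<Longrightarrow> fps_cong N g f"
  by (simp add: fps_cong_def)

lemma fps_cong_trans [trans]: "fps_cong N f g \<Longrightarrow> fps_cong N g h \<Longrightarrow> fps_cong N f h"
  by (simp add: fps_cong_def)

lemma fps_cong_mono: "fps_cong N f g \<Longrightarrow> M \<le> N \<Longrightarrow> fps_cong M f g"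
  by (simp add: fps_cong_def)

lemma fps_cong_mult: "fps_cong N f f' \<Longrightarrow> fps_cong N g g' \<Longrightarrow> fps_cong N (f * g) (f' * g')"
  by (auto simp: fps_cong_def fps_mult_nth intro!: sum.cong)

lemma fps_cong_sum: "(\<And>i. i \<in> A \<Longrightarrow> fps_cong N (f i) (g i)) \<Longrightarrow> fps_cong N (sum f A) (sum g A)"
  by (auto simp: fps_cong_def fps_sum_nth intro!: sum.cong)

text \<open>Multiplying by a power of the variable gains precision; this makes up for the less
  precise outer terms in the triple product.\<close>

lemma fps_cong_X_power_mult:
  "fps_cong N f g \<Longrightarrow> fps_cong (k + N) (fps_X ^ k * f) (fps_X ^ k * g)"
  by (auto simp: fps_cong_def fps_X_power_mult_nth)

lemma fps_eqI_cong: "(\<And>N. fps_cong N f g) \<Longrightarrow> f = g"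
  by (metis fps_cong_def fps_ext lessI)

section \<open>Euler products and their truncations\<close>

definition euler_poly :: "nat \<Rightarrow> nat \<Rightarrow> 'a::comm_ring_1 fps" where
  "euler_poly m N = (\<Prod>i\<in>{1..N}. (1 - fps_X ^ (m * i)))"

text \<open>The coefficient ring is left open: the statement concerns \<open>rat\<close>, while the
  argument takes place over \<open>bit\<close>.\<close>

definition euler :: "nat \<Rightarrow> 'a::comm_ring_1 fps" where
  "euler m = Abs_fps (\<lambda>n. fps_nth (euler_poly m n) n)"

lemma euler_fps_eq_euler: "euler_fps = euler"
  by (simp add: fun_eq_iff euler_fps_def euler_def euler_poly_def)

lemma euler_poly_0 [simp]: "euler_poly m 0 = 1"
  by (simp add: euler_poly_def)

lemma euler_poly_Suc: "euler_poly m (Suc N) = euler_poly m N * (1 - fps_X ^ (m * Suc N))"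
  by (simp add: euler_poly_def)

lemma euler_poly_nth_0 [simp]: "m > 0 \<Longrightarrow> fps_nth (euler_poly m N) 0 = 1"
  by (induction N) (auto simp: euler_poly_Suc)

lemma euler_nth_0 [simp]: "fps_nth (euler m) 0 = 1"
  by (simp add: euler_def)

lemma euler_poly_cong_Suc:
  assumes "m > 0"
  shows "fps_cong (Suc N) (euler_poly m (N + k)) (euler_poly m N)"
proof (induction k)
  case (Suc k)
  have "Suc N \<le> m * Suc (N + k)"
    using assms by (metis One_nat_def Suc_leI le_add1 mult_le_mono nat_mult_1 not_less_eq_eq add_Suc)
  hence "fps_cong (Suc N) (1 - fps_X ^ (m * Suc (N + k)) :: 'a fps) 1"
    by (auto simp: fps_cong_def fps_X_power_nth)
  from fps_cong_mult[OF Suc this] show ?case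
    by (simp add: euler_poly_Suc)
qed simp

lemma euler_poly_cong:
  assumes "m > 0" "N \<le> M" "N \<le> M'"
  shows "fps_cong (Suc N) (euler_poly m M) (euler_poly m M')"
  using euler_poly_cong_Suc[OF assms(1), of N "M - N"] euler_poly_cong_Suc[OF assms(1), of N "M' - N"]
    assms(2,3) by (auto intro: fps_cong_trans fps_cong_sym)

lemma euler_cong:
  assumes "m > 0" "N \<le> Suc M"
  shows "fps_cong N (euler m) (euler_poly m M)"
  unfolding fps_cong_def
proof (intro allI impI)
  fix i assume "i < N"
  with euler_poly_cong[OF assms(1), of i i M] assms(2)
  show "fps_nth (euler m) i = fps_nth (euler_poly m M) i"
    by (auto simp: euler_def fps_cong_def)
qed

text \<open>Equals a n(n+1)/2 + b n(n-1)/2, the exponent in Ramanujan's theta function f(q^a,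
  q^b).\<close>

definition theta_exponent :: "nat \<Rightarrow> nat \<Rightarrow> int \<Rightarrow> int" where
  "theta_exponent a b n = int (a + b) * (n * (n - 1) div 2) + int a * n"

lemma theta_exponent_doubled: "2 * theta_exponent a b n = int (a + b) * n * (n - 1) + 2 * int a * n"
proof -
  have "2 * (n * (n - 1) div 2) = n * (n - 1)" by simp
  then show ?thesis by (simp add: theta_exponent_def algebra_simps)
qed

lemma theta_exponent_step: "theta_exponent a b n = theta_exponent a b (n - 1) + int (a + b) * (n - 1) + int a"
proof -
  have "2 * theta_exponent a b n = 2 * (theta_exponent a b (n - 1) + int (a + b) * (n - 1) + int a)"
    unfolding distrib_left theta_exponent_doubled by (simp add: algebra_simps)
  thus ?thesis by simp
qed

lemma theta_exponent_swap: "theta_exponent b a (- n) = theta_exponent a b n"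
proof -
  have "2 * theta_exponent b a (- n) = 2 * theta_exponent a b n"
    unfolding theta_exponent_doubled by (simp add: algebra_simps)
  thus ?thesis by simp
qed

text \<open>For n >= 0 the linear term \<open>int a * n\<close> suffices, and negative n follow by
  \<open>theta_exponent_swap\<close>. The bound makes every theta coefficient a finite count and
  \<open>nat\<close> harmless on exponents.\<close>

lemma theta_exponent_ge:
  assumes "a > 0" "b > 0"
  shows "\<bar>n\<bar> \<le> theta_exponent a b n"
proof -
  have *: "n \<le> theta_exponent a b n" if "n \<ge> 0" "a > 0" for n a b
  proof -
    have "int (a + b) * n * (n - 1) \<ge> 0"
      using that by (cases "n = 0") auto
    moreover have "int a * n \<ge> 1 * n"
      using that by (intro mult_right_mono) auto
    ultimately show ?thesis
      using theta_exponent_doubled[of a b n] by linarith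
  qed
  show ?thesis
    using *[of n a b] *[of "-n" b a] assms theta_exponent_swap[of b a n] by (cases "n \<ge> 0") auto
qed

section \<open>The finite triple product\<close>

definition euler_recip :: "nat \<Rightarrow> int \<Rightarrow> 'a::field fps" where
  "euler_recip c k = (if k < 0 then 0 else inverse (euler_poly c (nat k)))"

text \<open>For k <= 0 both sides vanish, since \<open>nat k = 0\<close> turns the factor into 1 -
  1.\<close>

lemma euler_recip_pred:
  assumes "c > 0"
  shows "euler_recip c (k - 1) = (1 - fps_X ^ (c * nat k)) * euler_recip c k"
proof -
  consider "k < 0" | "k = 0" | "k > 0" by linarith
  thus ?thesis
  proof cases
    case 3
    then obtain j where k: "k = int (Suc j)"
      by (metis gr0_implies_Suc zero_less_imp_eq_int)
    have [simp]: "nat (1 + int j) = Suc j" by simp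
    have nz: "fps_nth (1 - fps_X ^ (c * Suc j) :: 'a fps) 0 \<noteq> 0"
      using assms by simp
    have "inverse (euler_poly c (Suc j) :: 'a fps) = inverse (euler_poly c j) * inverse (1 - fps_X ^ (c * Suc j))"
      by (simp only: euler_poly_Suc fps_inverse_mult)
    hence "(1 - fps_X ^ (c * Suc j)) * inverse (euler_poly c (Suc j)) =
       inverse (euler_poly c j) * (inverse (1 - fps_X ^ (c * Suc j)) * (1 - fps_X ^ (c * Suc j)) :: 'a fps)"
      by (simp only: mult_ac)
    also have "\<dots> = inverse (euler_poly c j)"
      by (simp only: inverse_mult_eq_1[OF nz] mult_1_right)
    finally show ?thesis
      by (simp add: euler_recip_def k del: mult_Suc_right)
  qed (auto simp: euler_recip_def)
qed

lemma euler_recip_cong: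
  assumes "c > 0" "N \<le> M" "int N \<le> k"
  shows "fps_cong (Suc N) (euler_poly c M * euler_recip c k) (1 :: 'a::field fps)"
proof -
  have nz: "fps_nth (euler_poly c (nat k) :: 'a fps) 0 \<noteq> 0"
    using assms by simp
  have "fps_cong (Suc N) (euler_poly c M * euler_recip c k)
      (euler_poly c (nat k) * euler_recip c k :: 'a fps)"
    using assms by (intro fps_cong_mult euler_poly_cong) auto
  also have "euler_poly c (nat k) * euler_recip c k = (1 :: 'a fps)"
    using assms inverse_mult_eq_1'[OF nz] by (simp add: euler_recip_def)
  finally show ?thesis .
qed

text \<open>The q-binomial coefficients of the finite triple product are kept as quotients of Euler
  products; the convention 0 for negative indices makes the Pascal rule hold at the boundary.\<close>

definition theta_sum :: "nat \<Rightarrow> nat \<Rightarrow> nat \<Rightarrow> nat \<Rightarrow> 'a::field fps" where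
  "theta_sum a b M N = (\<Sum>n\<in>{- int N..int M}. fps_X ^ nat (theta_exponent a b n) *
      (euler_recip (a + b) (int M - n) * euler_recip (a + b) (int N + n)))"

lemma theta_sum_swap: "theta_sum b a N M = theta_sum a b M N"
  unfolding theta_sum_def
  by (rule sum.reindex_bij_witness[of _ uminus uminus])
     (auto simp: theta_exponent_swap add_ac mult_ac)

text \<open>The extra factor contributes a second copy of the sum. Shifting its index by one gives
  both copies the factor \<open>fps_X ^ e n\<close>, and they then combine term by term as in the
  Pascal rule for q-binomials.\<close>

lemma theta_sum_step:
  assumes "a > 0" "b > 0"
  shows "(1 + fps_X ^ (a + (a + b) * M)) * theta_sum a b M N =
    (1 - fps_X ^ ((a + b) * Suc (M + N))) * (theta_sum a b (Suc M) N :: 'a::field fps)"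
proof -
  define c where "c = a + b"
  have c: "c > 0" using assms by (simp add: c_def)
  define e where "e = (\<lambda>n. nat (theta_exponent a b n))"
  define r where "r = (euler_recip c :: int \<Rightarrow> 'a fps)"
  let ?I = "{- int N..int (Suc M)}"
  have e: "theta_exponent a b n = int (e n)" for n
    using theta_exponent_ge[OF assms, of n] by (simp add: e_def)
  have r_neg: "r (-1) = 0" by (simp add: r_def euler_recip_def)
  \<comment> \<open>The added term n = M + 1 vanishes because \<open>euler_recip\<close> is 0 at
    -1.\<close>
  have 1: "theta_sum a b M N = (\<Sum>n\<in>?I. fps_X ^ e n * (r (int M - n) * r (int N + n)))"
    unfolding theta_sum_def e_def c_def[symmetric] r_def
    by (rule sum.mono_neutral_left) (auto simp: euler_recip_def)
  have "fps_X ^ (a + c * M) * theta_sum a b M N =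
     (\<Sum>n\<in>{- int N..int M}. fps_X ^ (a + c * M + e n) * (r (int M - n) * r (int N + n)))"
    unfolding theta_sum_def e_def c_def[symmetric] r_def
    by (simp add: sum_distrib_left power_add mult_ac)
  also have "\<dots> = (\<Sum>n\<in>{- int N + 1..int (Suc M)}. fps_X ^ (a + c * M + e (n - 1)) *
       (r (int (Suc M) - n) * r (int N + n - 1)))"
    by (rule sum.reindex_bij_witness[of _ "\<lambda>n. n - 1" "\<lambda>n. n + 1"]) (auto simp: algebra_simps)
  also have "\<dots> = (\<Sum>n\<in>?I. fps_X ^ (a + c * M + e (n - 1)) *
       (r (int (Suc M) - n) * r (int N + n - 1)))"
  proof (intro sum.mono_neutral_left ballI)
    fix n assume "n \<in> ?I - {- int N + 1..int (Suc M)}"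
    hence "n = - int N" by auto
    thus "fps_X ^ (a + c * M + e (n - 1)) * (r (int (Suc M) - n) * r (int N + n - 1)) = 0"
      using r_neg by simp
  qed auto
  also have "\<dots> = (\<Sum>n\<in>?I. fps_X ^ (e n + c * nat (int (Suc M) - n)) *
       (r (int (Suc M) - n) * r (int N + n - 1)))"
  proof (intro sum.cong refl)
    fix n assume n: "n \<in> ?I"
    have "int (a + c * M + e (n - 1)) = int (e n + c * nat (int (Suc M) - n))"
      using n e[of n] e[of "n - 1"] theta_exponent_step[of a b n]
      by (simp add: c_def algebra_simps)
    hence "a + c * M + e (n - 1) = e n + c * nat (int (Suc M) - n)"
      by (simp only: of_nat_eq_iff)
    thus "fps_X ^ (a + c * M + e (n - 1)) * (r (int (Suc M) - n) * r (int N + n - 1)) =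
      fps_X ^ (e n + c * nat (int (Suc M) - n)) * (r (int (Suc M) - n) * r (int N + n - 1))"
      by simp
  qed
  finally have 2: "fps_X ^ (a + c * M) * theta_sum a b M N = \<dots>" .
  have "(1 + fps_X ^ (a + c * M)) * theta_sum a b M N =
    (\<Sum>n\<in>?I. fps_X ^ e n * (r (int M - n) * r (int N + n)) +
      fps_X ^ (e n + c * nat (int (Suc M) - n)) * (r (int (Suc M) - n) * r (int N + n - 1)))"
    unfolding distrib_right 2 sum.distrib by (simp add: 1)
  also have "\<dots> = (\<Sum>n\<in>?I. (1 - fps_X ^ (c * Suc (M + N))) *
      (fps_X ^ e n * (r (int (Suc M) - n) * r (int N + n))))"
  proof (intro sum.cong refl)
    fix n assume n: "n \<in> ?I"
    \<comment> \<open>The copies combine by (1 - X^(c u)) + X^(c u) (1 - X^(c v)) = 1 - X^(c (u +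
      v)), where u + v is the same for every n.\<close>
    define u where "u = nat (int (Suc M) - n)"
    define v where "v = nat (int N + n)"
    have uv: "u + v = Suc (M + N)" using n by (auto simp: u_def v_def)
    have 3: "r (int M - n) = (1 - fps_X ^ (c * u)) * r (int (Suc M) - n)"
      using euler_recip_pred[OF c, of "int (Suc M) - n"] by (simp add: r_def u_def algebra_simps)
    have 4: "r (int N + n - 1) = (1 - fps_X ^ (c * v)) * r (int N + n)"
      using euler_recip_pred[OF c, of "int N + n"] by (simp add: r_def v_def)
    have 5: "fps_X ^ (c * Suc (M + N)) = fps_X ^ (c * u) * (fps_X ^ (c * v) :: 'a fps)"
      by (simp only: uv[symmetric] distrib_left power_add)
    show "fps_X ^ e n * (r (int M - n) * r (int N + n)) +
      fps_X ^ (e n + c * nat (int (Suc M) - n)) * (r (int (Suc M) - n) * r (int N + n - 1)) =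
      (1 - fps_X ^ (c * Suc (M + N))) * (fps_X ^ e n * (r (int (Suc M) - n) * r (int N + n)))"
      unfolding 3 4 5 u_def[symmetric] power_add by (simp only: algebra_simps mult_1_left)
  qed
  also have "\<dots> = (1 - fps_X ^ (c * Suc (M + N))) * theta_sum a b (Suc M) N"
    by (simp only: sum_distrib_left theta_sum_def c_def r_def e_def)
  finally show ?thesis by (simp only: c_def)
qed

lemma finite_jacobi_triple_product:
  assumes "a > 0" "b > 0"
  shows "(\<Prod>i<M. 1 + fps_X ^ (a + (a + b) * i)) * (\<Prod>i<N. 1 + fps_X ^ (b + (a + b) * i)) =
    euler_poly (a + b) (M + N) * (theta_sum a b M N :: 'a::field fps)"
proof -
  \<comment> \<open>Stated for all \<open>a\<close>, \<open>b\<close> and \<open>F\<close> because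
    it is applied twice: with \<open>a\<close> and \<open>b\<close> exchanged and F = 1 to build the
    second product, then with that product as \<open>F\<close> to build the first.\<close>
  have step: "(\<Prod>i<M. 1 + fps_X ^ (a + (a + b) * i)) * F =
    euler_poly (a + b) (M + N) * (theta_sum a b M N :: 'a fps)"
    if "F = euler_poly (a + b) N * theta_sum a b 0 N" "a > 0" "b > 0" for F a b M N
  proof (induction M)
    case 0
    show ?case using that by simp
  next
    case (Suc M)
    have "(\<Prod>i<Suc M. 1 + fps_X ^ (a + (a + b) * i)) * F = (1 + fps_X ^ (a + (a + b) * M)) *
        ((\<Prod>i<M. 1 + fps_X ^ (a + (a + b) * i)) * F)"
      by (simp add: mult_ac)
    also have "\<dots> = euler_poly (a + b) (M + N) * ((1 + fps_X ^ (a + (a + b) * M)) * theta_sum a b M N)"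
      unfolding Suc by (simp only: mult_ac)
    also have "\<dots> = euler_poly (a + b) (Suc M + N) * theta_sum a b (Suc M) N"
      unfolding theta_sum_step[OF that(2,3)] by (simp only: add_Suc euler_poly_Suc mult_ac)
    finally show ?case .
  qed
  have base: "theta_sum a b 0 0 = (1 :: 'a fps)" for a b
    by (simp add: theta_sum_def euler_recip_def theta_exponent_def)
  have "(\<Prod>i<N. 1 + fps_X ^ (b + (b + a) * i)) * 1 =
    euler_poly (b + a) (N + 0) * (theta_sum b a N 0 :: 'a fps)"
    by (intro step) (use assms base in auto)
  hence "(\<Prod>i<N. 1 + fps_X ^ (b + (a + b) * i)) =
    euler_poly (a + b) N * (theta_sum a b 0 N :: 'a fps)"
    by (simp add: theta_sum_swap[of b a] add.commute)
  from step[OF this assms] show ?thesis .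
qed

section \<open>Theta series and the triple product for them\<close>

definition theta :: "nat \<Rightarrow> nat \<Rightarrow> 'a::comm_ring_1 fps" where
  "theta a b = Abs_fps (\<lambda>m. of_nat (card {n. theta_exponent a b n = int m}))"

lemma finite_theta_exponent:
  assumes "a > 0" "b > 0"
  shows "finite {n. theta_exponent a b n = int m}"
proof (rule finite_subset)
  show "{n. theta_exponent a b n = int m} \<subseteq> {- int m..int m}"
  proof
    fix n assume "n \<in> {n. theta_exponent a b n = int m}"
    with theta_exponent_ge[OF assms, of n] show "n \<in> {- int m..int m}" by auto
  qed
qed auto

text \<open>Multiplying the finite identity by one more Euler product cancels the reciprocals of the
  n-th term with precision N - |n|. The missing |n| orders come from \<open>fps_X ^ e n\<close>, as
  e n >= |n|.\<close>

lemma jacobi_triple_product: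
  assumes "a > 0" "b > 0"
  shows "fps_cong (Suc N) ((\<Prod>i<N. 1 + fps_X ^ (a + (a + b) * i)) *
      (\<Prod>i<N. 1 + fps_X ^ (b + (a + b) * i)) * euler_poly (a + b) N) (theta a b :: 'a::field fps)"
proof -
  define c where "c = a + b"
  have c: "c > 0" using assms by (simp add: c_def)
  define e where "e = (\<lambda>n. nat (theta_exponent a b n))"
  have e: "theta_exponent a b n = int (e n)" for n
    using theta_exponent_ge[OF assms, of n] by (simp add: e_def)
  have e_ge: "nat \<bar>n\<bar> \<le> e n" for n
    using theta_exponent_ge[OF assms, of n] by (simp add: e_def)
  let ?I = "{- int N..int N}"
  have "(\<Prod>i<N. 1 + fps_X ^ (a + (a + b) * i)) *
      (\<Prod>i<N. 1 + fps_X ^ (b + (a + b) * i)) * euler_poly (a + b) N =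
    (\<Sum>n\<in>?I. fps_X ^ e n * ((euler_poly c N * euler_recip c (int N - n)) *
      (euler_poly c (N + N) * euler_recip c (int N + n))) :: 'a fps)"
    unfolding finite_jacobi_triple_product[OF assms] theta_sum_def e_def
      sum_distrib_left sum_distrib_right
    by (simp only: c_def mult_ac)
  also have "fps_cong (Suc N) \<dots> (\<Sum>n\<in>?I. fps_X ^ e n)"
  proof (rule fps_cong_sum)
    fix n assume n: "n \<in> ?I"
    define k where "k = N - nat \<bar>n\<bar>"
    have "fps_cong (Suc k) ((euler_poly c N * euler_recip c (int N - n)) *
      (euler_poly c (N + N) * euler_recip c (int N + n))) (1 * 1 :: 'a fps)"
      using n by (intro fps_cong_mult euler_recip_cong c) (auto simp: k_def)
    hence "fps_cong (e n + Suc k) (fps_X ^ e n * ((euler_poly c N * euler_recip c (int N - n)) *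
      (euler_poly c (N + N) * euler_recip c (int N + n)))) (fps_X ^ e n * (1 * 1) :: 'a fps)"
      by (rule fps_cong_X_power_mult)
    moreover have "Suc N \<le> e n + Suc k" using e_ge[of n] by (auto simp: k_def)
    ultimately show "fps_cong (Suc N) (fps_X ^ e n * ((euler_poly c N * euler_recip c (int N - n)) *
      (euler_poly c (N + N) * euler_recip c (int N + n)))) (fps_X ^ e n :: 'a fps)"
      by (auto intro: fps_cong_mono)
  qed
  \<comment> \<open>An exponent of at most \<open>N\<close> forces |n| <= N, so the range
    \<open>?I\<close> loses no term.\<close>
  also have "fps_cong (Suc N) (\<Sum>n\<in>?I. fps_X ^ e n) (theta a b :: 'a fps)"
    unfolding fps_cong_def
  proof (intro allI impI)
    fix m assume m: "m < Suc N"
    have "{n\<in>?I. m = e n} = {n. theta_exponent a b n = int m}"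
    proof (intro set_eqI iffI)
      fix n assume "n \<in> {n. theta_exponent a b n = int m}"
      with m e_ge[of n] show "n \<in> {n\<in>?I. m = e n}" by (auto simp: e)
    qed (auto simp: e)
    moreover have "fps_nth (\<Sum>n\<in>?I. fps_X ^ e n) m = (of_nat (card {n\<in>?I. m = e n}) :: 'a)"
      by (simp add: fps_sum_nth fps_X_power_nth sum.If_cases Int_def)
    ultimately show "fps_nth (\<Sum>n\<in>?I. fps_X ^ e n) m = fps_nth (theta a b :: 'a fps) m"
      by (simp add: theta_def)
  qed
  finally show ?thesis .
qed

subsection \<open>Euler products modulo 2\<close>

text \<open>The points moved by \<open>g\<close> form pairs with equal values, and these cancel in
  characteristic 2.\<close>

lemma sum_involution_bit:
  fixes h :: "'a \<Rightarrow> bit"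
  assumes "finite A" "\<And>x. x \<in> A \<Longrightarrow> g x \<in> A" "\<And>x. x \<in> A \<Longrightarrow> g (g x) = x"
    and "\<And>x. x \<in> A \<Longrightarrow> h (g x) = h x"
  shows "sum h A = sum h {x\<in>A. g x = x}"
proof -
  have "sum h B = 0" if "finite B" "\<And>x. x \<in> B \<Longrightarrow> g x \<in> B \<and> g (g x) = x \<and> h (g x) = h x \<and> g x \<noteq> x" for B
    using that
  proof (induction B rule: finite_psubset_induct)
    case (psubset B)
    show ?case
    proof (cases "B = {}")
      case False
      then obtain x where x: "x \<in> B" by blast
      define C where "C = B - {x, g x}"
      have "sum h C = 0"
      proof (rule psubset.IH)
        show "C \<subset> B" using x by (auto simp: C_def)
        fix y assume "y \<in> C"
        thus "g y \<in> C \<and> g (g y) = y \<and> h (g y) = h y \<and> g y \<noteq> y"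
          using psubset.prems x unfolding C_def by (metis Diff_iff insert_iff singletonD)
      qed
      moreover have "B = insert x (insert (g x) C)" "x \<notin> insert (g x) C" "g x \<notin> C" "finite C"
        using psubset.prems[of x] psubset.hyps x by (auto simp: C_def)
      ultimately show ?thesis
        using psubset.prems[OF x] by (simp flip: add.assoc)
    qed simp
  qed
  note * = this
  have "sum h A = sum h {x\<in>A. g x = x} + sum h {x\<in>A. g x \<noteq> x}"
    using assms(1) by (subst sum.union_disjoint[symmetric]) (auto intro: sum.cong)
  moreover have "sum h {x\<in>A. g x \<noteq> x} = 0"
    using assms by (intro *) auto
  ultimately show ?thesis by simp
qed

lemma of_nat_bit_eq_iff: "(of_nat m :: bit) = of_nat n \<longleftrightarrow> (even m \<longleftrightarrow> even n)"
  by (metis Z2.bit_eq_iff even_of_nat)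

lemma card_involution_parity:
  assumes "finite A" "\<And>x. x \<in> A \<Longrightarrow> g x \<in> A" "\<And>x. x \<in> A \<Longrightarrow> g (g x) = x"
  shows "even (card A) \<longleftrightarrow> even (card {x\<in>A. g x = x})"
proof -
  have "(of_nat (card A) :: bit) = of_nat (card {x\<in>A. g x = x})"
    using sum_involution_bit[OF assms, of "\<lambda>_. 1"] by (simp only: sum_constant mult_1_right)
  thus ?thesis by (simp only: of_nat_bit_eq_iff)
qed

text \<open>Swapping i and n - i cancels all off-diagonal products, and x * x = x in
  \<open>bit\<close>.\<close>

lemma fps_power2_nth_bit:
  fixes f :: "bit fps"
  shows "fps_nth (f ^ 2) n = (if even n then fps_nth f (n div 2) else 0)"
proof -
  have "fps_nth (f ^ 2) n = (\<Sum>i=0..n. fps_nth f i * fps_nth f (n - i))"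
    by (simp add: power2_eq_square fps_mult_nth)
  also have "\<dots> = (\<Sum>i\<in>{i\<in>{0..n}. n - i = i}. fps_nth f i * fps_nth f (n - i))"
    by (rule sum_involution_bit) (auto simp: mult.commute)
  also have "{i\<in>{0..n}. n - i = i} = (if even n then {n div 2} else {})"
    by (auto, presburger+)
  finally have sum: "fps_nth (f ^ 2) n =
    (\<Sum>i\<in>(if even n then {n div 2} else {}). fps_nth f i * fps_nth f (n - i))" .
  have "x * x = x" for x :: bit by (cases x) simp_all
  thus ?thesis unfolding sum by (cases "even n")
    (auto simp only: if_True if_False sum.empty sum.insert finite.emptyI empty_iff
      elim!: evenE, simp)
qed

lemma fps_bit_diff_eq: "f - g = f + (g :: bit fps)"
  by (simp add: fps_eq_iff)

lemma fps_bit_add_self: "f + f = (0 :: bit fps)"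
proof (rule fps_ext)
  fix n
  show "fps_nth (f + f) n = fps_nth 0 n"
    by (cases "fps_nth f n") (simp_all only: fps_add_nth fps_zero_nth add_0 one_add_one bit_2_eq_0)
qed

lemma fps_bit_power2_add: "(f + g) ^ 2 = f ^ 2 + (g :: bit fps) ^ 2"
proof -
  have "(f + g) ^ 2 = f ^ 2 + g ^ 2 + (f * g + f * g)"
    by (simp only: power2_eq_square algebra_simps)
  thus ?thesis by (simp only: fps_bit_add_self add_0_right)
qed

text \<open>Squaring is additive in characteristic 2, so each factor of \<open>euler m\<close>
  squares to the corresponding factor of \<open>euler (2 * m)\<close>.\<close>

lemma euler_double: "m > 0 \<Longrightarrow> euler (2 * m) = (euler m ^ 2 :: bit fps)"
proof (rule fps_eqI_cong)
  fix N assume m: "m > 0"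
  have "fps_cong N (euler (2 * m)) (euler_poly (2 * m) N :: bit fps)"
    using m by (intro euler_cong) auto
  also have "euler_poly (2 * m) N = (euler_poly m N ^ 2 :: bit fps)"
  proof (induction N)
    case (Suc N)
    have "1 - fps_X ^ (2 * m * Suc N) = (1 - fps_X ^ (m * Suc N) :: bit fps) ^ 2"
      unfolding fps_bit_diff_eq fps_bit_power2_add
      by (simp flip: power_mult add: mult_ac del: mult_Suc_right mult_Suc)
    thus ?case by (simp only: euler_poly_Suc Suc power_mult_distrib)
  qed simp
  also have "fps_cong N \<dots> (euler m ^ 2)"
    unfolding power2_eq_square using m by (intro fps_cong_mult fps_cong_sym[OF euler_cong]) auto
  finally show "fps_cong N (euler (2 * m)) (euler m ^ 2 :: bit fps)" .
qed

lemma euler_nonzero [simp]: "euler m \<noteq> 0"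
  by (metis euler_nth_0 fps_zero_nth zero_neq_one)

text \<open>With E = \<open>euler d\<close>, the triple product gives theta *
  \<open>euler (2 * d)\<close> = E * \<open>euler (4 * d)\<close>. By \<open>euler_double\<close>
  this reads theta * E^2 = E^5, and E^2 cancels.\<close>

lemma euler_cubed:
  assumes "d > 0"
  shows "euler d ^ 3 = (theta d (3 * d) :: bit fps)"
proof -
  let ?P = "\<lambda>N. (\<Prod>i<N. 1 + fps_X ^ (d + (d + 3 * d) * i)) * (\<Prod>i<N. 1 + fps_X ^ (3 * d + (d + 3 * d) * i)) :: bit fps"
  \<comment> \<open>Signs disappear over \<open>bit\<close>: \<open>?P\<close> supplies the odd
    multiples of d, the other product the even ones.\<close>
  have prod: "?P N * euler_poly (2 * d) (2 * N) = euler_poly d (4 * N)" for N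
  proof (induction N)
    case (Suc N)
    have two: "2 * Suc N = Suc (Suc (2 * N))" by simp
    have "?P (Suc N) * euler_poly (2 * d) (2 * Suc N) = ?P N * euler_poly (2 * d) (2 * N) *
      ((1 + fps_X ^ (d + (d + 3 * d) * N)) * (1 + fps_X ^ (3 * d + (d + 3 * d) * N)) *
       (1 + fps_X ^ (2 * d * Suc (2 * N))) * (1 + fps_X ^ (2 * d * Suc (Suc (2 * N)))))"
      unfolding two euler_poly_Suc prod.lessThan_Suc fps_bit_diff_eq
      by (simp only: mult_ac)
    also have "\<dots> = euler_poly d (4 * N) * ((1 + fps_X ^ (d * Suc (4 * N))) * (1 + fps_X ^ (d * Suc (Suc (Suc (4 * N))))) *
       (1 + fps_X ^ (d * Suc (Suc (4 * N)))) * (1 + fps_X ^ (d * Suc (Suc (Suc (Suc (4 * N)))))))"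
      unfolding Suc by (simp add: algebra_simps)
    also have "\<dots> = euler_poly d (Suc (Suc (Suc (Suc (4 * N)))))"
      unfolding euler_poly_Suc fps_bit_diff_eq by (simp only: mult_ac)
    also have "Suc (Suc (Suc (Suc (4 * N)))) = 4 * Suc N" by simp
    finally show ?case .
  qed simp
  have "theta d (3 * d) * euler (2 * d) = (euler d * euler (4 * d) :: bit fps)"
  proof (rule fps_eqI_cong)
    fix N
    have "fps_cong N (theta d (3 * d) * euler (2 * d))
        (?P N * euler_poly (d + 3 * d) N * euler_poly (2 * d) (2 * N))"
      using assms by (intro fps_cong_mult fps_cong_sym[OF fps_cong_mono[OF jacobi_triple_product]] euler_cong) auto
    also have "\<dots> = ?P N * euler_poly (2 * d) (2 * N) * euler_poly (d + 3 * d) N"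
      by (simp only: mult_ac)
    also have "\<dots> = euler_poly d (4 * N) * euler_poly (4 * d) N"
      unfolding prod by simp
    also have "fps_cong N \<dots> (euler d * euler (4 * d))"
      using assms by (intro fps_cong_mult fps_cong_sym[OF euler_cong]) auto
    finally show "fps_cong N (theta d (3 * d) * euler (2 * d)) (euler d * euler (4 * d) :: bit fps)" .
  qed
  moreover have "euler (4 * d) = (euler d ^ 4 :: bit fps)"
    using euler_double[of "2 * d"] euler_double[of d] assms by (simp flip: power_mult)
  ultimately have "theta d (3 * d) * euler d ^ 2 = (euler d ^ 3 * euler d ^ 2 :: bit fps)"
    using euler_double[of d] assms by (simp add: eval_nat_numeral mult_ac)
  moreover have "euler d ^ 2 \<noteq> (0 :: bit fps)" by simp
  ultimately show ?thesis by (metis mult_right_cancel)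
qed

text \<open>The factors of \<open>euler 1\<close> are split by residue modulo 5: classes 1, 4 and 2,
  3 are the linear products of the two theta series, class 0 is \<open>euler 5\<close>. Each theta
  series carries a further \<open>euler 5\<close>; one copy is cancelled.\<close>

lemma euler_1_mult_euler_5: "euler 1 * euler 5 = (theta 1 4 * theta 2 3 :: bit fps)"
proof -
  let ?P = "\<lambda>a b N. (\<Prod>i<N. 1 + fps_X ^ (a + (a + b) * i)) * (\<Prod>i<N. 1 + fps_X ^ (b + (a + b) * i)) :: bit fps"
  have prod: "?P 1 4 N * ?P 2 3 N * euler_poly 5 N = euler_poly 1 (5 * N)" for N
  proof (induction N)
    case (Suc N)
    have "?P 1 4 (Suc N) * ?P 2 3 (Suc N) * euler_poly 5 (Suc N) =
      ?P 1 4 N * ?P 2 3 N * euler_poly 5 N *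
      ((1 + fps_X ^ (1 + (1 + 4) * N)) * (1 + fps_X ^ (4 + (1 + 4) * N)) *
       ((1 + fps_X ^ (2 + (2 + 3) * N)) * (1 + fps_X ^ (3 + (2 + 3) * N))) *
       (1 + fps_X ^ (5 * Suc N)))"
      unfolding euler_poly_Suc prod.lessThan_Suc fps_bit_diff_eq by (simp only: mult_ac)
    also have "\<dots> = euler_poly 1 (5 * N) * ((1 + fps_X ^ (1 * Suc (5 * N))) * (1 + fps_X ^ (1 * Suc (Suc (5 * N)))) *
       (1 + fps_X ^ (1 * Suc (Suc (Suc (5 * N))))) * (1 + fps_X ^ (1 * Suc (Suc (Suc (Suc (5 * N)))))) *
       (1 + fps_X ^ (1 * Suc (Suc (Suc (Suc (Suc (5 * N))))))))"
      unfolding Suc by (simp add: eval_nat_numeral mult_ac)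
    also have "\<dots> = euler_poly 1 (Suc (Suc (Suc (Suc (Suc (5 * N))))))"
      unfolding euler_poly_Suc fps_bit_diff_eq by (simp only: mult_ac)
    also have "Suc (Suc (Suc (Suc (Suc (5 * N))))) = 5 * Suc N" by simp
    finally show ?case .
  qed simp
  have "theta 1 4 * theta 2 3 * euler 5 = (euler 1 * euler 5 * euler 5 :: bit fps)"
  proof (rule fps_eqI_cong)
    fix N
    have "fps_cong N (theta 1 4 * theta 2 3 * euler 5)
        ((?P 1 4 N * euler_poly (1 + 4) N) * (?P 2 3 N * euler_poly (2 + 3) N) * euler_poly 5 N)"
      by (intro fps_cong_mult fps_cong_sym[OF fps_cong_mono[OF jacobi_triple_product]] euler_cong) auto
    also have "\<dots> = (?P 1 4 N * ?P 2 3 N * euler_poly 5 N) * euler_poly 5 N * euler_poly 5 N"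
      by (simp add: mult_ac)
    also have "\<dots> = euler_poly 1 (5 * N) * euler_poly 5 N * euler_poly 5 N"
      unfolding prod ..
    also have "fps_cong N \<dots> (euler 1 * euler 5 * euler 5)"
      by (intro fps_cong_mult fps_cong_sym[OF euler_cong]) auto
    finally show "fps_cong N (theta 1 4 * theta 2 3 * euler 5) (euler 1 * euler 5 * euler 5 :: bit fps)" .
  qed
  thus ?thesis by simp
qed

text \<open>Completing the square turns d (2 n^2 - n) = t into d (4 n - 1)^2 = 8 t + d, and squaring
  the series moves index t to m = 2 t.\<close>

lemma theta_3_power2_nth:
  assumes "odd d"
  shows "fps_nth (theta d (3 * d) ^ 2 :: bit fps) m = of_bool (\<exists>s. int d * s ^ 2 = 4 * int m + int d)"
proof -
  have d: "d > 0" using assms by (auto intro: Nat.gr0I)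
  have expo: "theta_exponent d (3 * d) n = int d * (2 * n ^ 2 - n)" for n
    using theta_exponent_doubled[of d "3 * d" n] by (simp add: algebra_simps power2_eq_square)
  have odd_s: "odd s" if "int d * s ^ 2 = 4 * int m + int d" for s
  proof
    assume "even s"
    hence "even (4 * int m + int d)" unfolding that[symmetric] by simp
    with assms show False by simp
  qed
  show ?thesis
  proof (cases "even m")
    case True
    then obtain t where m: "m = 2 * t" by blast
    let ?A = "{n. theta_exponent d (3 * d) n = int t}"
    have sq: "theta_exponent d (3 * d) n = int t \<longleftrightarrow> int d * (4 * n - 1) ^ 2 = 4 * int m + int d" for n
      unfolding expo m by (auto simp: algebra_simps power2_eq_square)
    \<comment> \<open>Numbers 4 n - 1 are 3 modulo 4, so they are never negatives of each other and
      the solution is unique.\<close>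
    have "x = y" if "x \<in> ?A" "y \<in> ?A" for x y
    proof -
      have "int d * (4 * x - 1) ^ 2 = int d * (4 * y - 1) ^ 2"
        using that sq by auto
      hence "(4 * x - 1) ^ 2 = (4 * y - 1) ^ 2" using d by simp
      hence "4 * x - 1 = 4 * y - 1 \<or> 4 * x - 1 = - (4 * y - 1)" by (simp add: power2_eq_iff)
      thus "x = y" by presburger
    qed
    hence card: "card ?A = of_bool (?A \<noteq> {})"
      by (cases "?A = {}") (auto simp: card_1_singleton_iff)
    have "?A \<noteq> {} \<longleftrightarrow> (\<exists>s. int d * s ^ 2 = 4 * int m + int d)"
    proof
      assume "\<exists>s. int d * s ^ 2 = 4 * int m + int d"
      then obtain s where s: "int d * s ^ 2 = 4 * int m + int d" by blast
      from odd_s[OF s] have "\<exists>n. s = 4 * n - 1 \<or> - s = 4 * n - 1" by presburger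
      then obtain n where "s = 4 * n - 1 \<or> - s = 4 * n - 1" by blast
      hence "(4 * n - 1) ^ 2 = s ^ 2" by (metis power2_minus)
      with s sq[of n] show "?A \<noteq> {}" by auto
    qed (use sq in auto)
    thus ?thesis
      unfolding fps_power2_nth_bit using card by (simp add: m theta_def)
  next
    case False
    \<comment> \<open>An odd s = 2 k + 1 would give m = d k (k + 1), which is even.\<close>
    have "\<not> (\<exists>s. int d * s ^ 2 = 4 * int m + int d)"
    proof
      assume "\<exists>s. int d * s ^ 2 = 4 * int m + int d"
      then obtain s where s: "int d * s ^ 2 = 4 * int m + int d" by blast
      from odd_s[OF s] obtain k where k: "s = 2 * k + 1" by (elim oddE)
      from s have "int d * (k * (k + 1)) = int m"
        by (simp add: k algebra_simps power2_eq_square)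
      moreover have "even (int d * (k * (k + 1)))" by simp
      ultimately show False using False by simp
    qed
    thus ?thesis unfolding fps_power2_nth_bit using False by simp
  qed
qed

lemma theta_mult_nth:
  assumes "a > 0" "b > 0" "a' > 0" "b' > 0"
  shows "fps_nth (theta a b * theta a' b') m =
    of_nat (card {(x, y). theta_exponent a b x + theta_exponent a' b' y = int m})"
proof -
  let ?A = "\<lambda>i. {x. theta_exponent a b x = int i}"
  let ?B = "\<lambda>i. {x. theta_exponent a' b' x = int i}"
  have "{(x, y). theta_exponent a b x + theta_exponent a' b' y = int m} = (\<Union>i\<in>{0..m}. ?A i \<times> ?B (m - i))"
  proof (intro set_eqI iffI)
    fix z assume z: "z \<in> {(x, y). theta_exponent a b x + theta_exponent a' b' y = int m}"
    obtain x y where xy: "z = (x, y)" by fastforce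
    have "theta_exponent a b x \<ge> 0" "theta_exponent a' b' y \<ge> 0"
      using theta_exponent_ge[of a b x] theta_exponent_ge[of a' b' y] assms by auto
    with z xy have "nat (theta_exponent a b x) \<in> {0..m}"
        "z \<in> ?A (nat (theta_exponent a b x)) \<times> ?B (m - nat (theta_exponent a b x))"
      by auto
    thus "z \<in> (\<Union>i\<in>{0..m}. ?A i \<times> ?B (m - i))" by blast
  qed auto
  also have "card \<dots> = (\<Sum>i=0..m. card (?A i \<times> ?B (m - i)))"
    by (intro card_UN_disjoint ballI impI finite_cartesian_product finite_theta_exponent assms) auto
  finally show ?thesis
    by (simp add: fps_mult_nth theta_def card_cartesian_product)
qed

subsection \<open>Parity of representation counts\<close>

text \<open>Summing the hypothesis over \<open>T\<close> counts \<open>T\<close> once, while each of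
  the four sums equals the count of \<open>P\<close> because \<open>r\<close> permutes
  \<open>T\<close>. Two choices of \<open>P\<close> for the same \<open>r\<close> therefore have
  equal counts.\<close>

lemma card_four_cycle:
  assumes fin: "finite T" and inj: "inj_on r T" and im: "r ` T = T"
    and one: "\<And>x. x \<in> T \<Longrightarrow> of_bool (P x) + of_bool (P (r x)) + of_bool (P (r (r x))) +
      of_bool (P (r (r (r x)))) = (1 :: nat)"
  shows "card T = 4 * card {x\<in>T. P x}"
proof -
  have shift: "(\<Sum>x\<in>T. f (r x)) = sum f T" for f :: "'a \<Rightarrow> nat"
    using sum.reindex[OF inj, of f] im by simp
  have "card T = (\<Sum>x\<in>T. of_bool (P x) + of_bool (P (r x)) + of_bool (P (r (r x))) +
      of_bool (P (r (r (r x)))))"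
    using one by simp
  also have "\<dots> = 4 * (\<Sum>x\<in>T. of_bool (P x))"
    using shift[of "\<lambda>x. of_bool (P x)"] shift[of "\<lambda>x. of_bool (P (r x))"]
      shift[of "\<lambda>x. of_bool (P (r (r x)))"]
    by (simp only: sum.distrib)
  also have "(\<Sum>x\<in>T. of_bool (P x)) = card {x\<in>T. P x}"
    using fin by (simp add: of_bool_def sum.If_cases Int_def)
  finally show ?thesis .
qed

lemma finite_sum_two_squares: "finite {(u, v). u ^ 2 + v ^ 2 = (M::int)}"
proof (rule finite_subset)
  show "{(u, v). u ^ 2 + v ^ 2 = M} \<subseteq> {-\<bar>M\<bar>..\<bar>M\<bar>} \<times> {-\<bar>M\<bar>..\<bar>M\<bar>}"
  proof
    fix z assume z: "z \<in> {(u, v). u ^ 2 + v ^ 2 = M}"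
    obtain u v where uv: "z = (u, v)" by fastforce
    have *: "\<bar>x\<bar> \<le> x ^ 2" for x :: int
    proof (cases "x = 0")
      case False
      hence "\<bar>x\<bar> * 1 \<le> \<bar>x\<bar> * \<bar>x\<bar>" by (intro mult_left_mono) auto
      thus ?thesis by (simp add: power2_eq_square)
    qed simp
    have "\<bar>u\<bar> \<le> \<bar>M\<bar>" "\<bar>v\<bar> \<le> \<bar>M\<bar>"
      using z uv *[of u] *[of v] by auto
    thus "z \<in> {-\<bar>M\<bar>..\<bar>M\<bar>} \<times> {-\<bar>M\<bar>..\<bar>M\<bar>}" using uv by auto
  qed
qed auto

lemma odd_sum_two_squares:
  fixes u v M :: int
  assumes "u ^ 2 + v ^ 2 = M" "odd M"
  shows "odd u \<longleftrightarrow> even v"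
  using assms by auto

text \<open>The involution v -> -v fixes only v = 0, which leaves the positive square root of
  \<open>M\<close> if there is one.\<close>

lemma card_odd_positive_parity:
  fixes M :: int
  assumes "odd M"
  shows "even (card {(u, v). u ^ 2 + v ^ 2 = M \<and> odd u \<and> u > 0}) \<longleftrightarrow> \<not> (\<exists>s. s ^ 2 = M)"
proof -
  define A where "A = {(u, v). u ^ 2 + v ^ 2 = M \<and> odd u \<and> u > 0}"
  define g :: "int \<times> int \<Rightarrow> int \<times> int" where "g = (\<lambda>(u, v). (u, - v))"
  have "finite A"
    by (rule finite_subset[OF _ finite_sum_two_squares[of M]]) (auto simp: A_def)
  hence "even (card A) \<longleftrightarrow> even (card {x\<in>A. g x = x})"
    by (rule card_involution_parity) (auto simp: A_def g_def)
  moreover have "{x\<in>A. g x = x} = {(u, v). v = 0 \<and> u ^ 2 = M \<and> u > 0}"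
    using assms by (auto simp: A_def g_def)
  moreover have "card {(u, v). v = (0::int) \<and> u ^ 2 = M \<and> u > 0} = of_bool (\<exists>s. s ^ 2 = M)"
  proof (cases "\<exists>s. s ^ 2 = M")
    case True
    then obtain s where s: "s ^ 2 = M" by blast
    have "{(u, v). v = (0::int) \<and> u ^ 2 = M \<and> u > 0} = {(\<bar>s\<bar>, 0)}"
      using s assms by (auto simp: power2_eq_iff)
    thus ?thesis using True by simp
  next
    case False
    hence "{(u, v). v = (0::int) \<and> u ^ 2 = M \<and> u > 0} = {}" by auto
    thus ?thesis using False by simp
  qed
  ultimately show ?thesis by (simp add: A_def)
qed

text \<open>The involution conjugates the quotient of u + iv by 2 + i, which exists in the Gaussian
  integers because 5 divides u + 3v; the sign keeps the real part positive.\<close>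

lemma card_odd_positive_5_parity:
  fixes M :: int
  assumes "odd M"
  shows "even (card {(u, v). u ^ 2 + v ^ 2 = M \<and> odd u \<and> u > 0 \<and> 5 dvd u + 3 * v}) \<longleftrightarrow>
    \<not> (\<exists>s. 5 * s ^ 2 = M)"
proof -
  define A where "A = {(u, v). u ^ 2 + v ^ 2 = M \<and> odd u \<and> u > 0 \<and> 5 dvd u + 3 * v}"
  \<comment> \<open>The coordinates come from (u - iv)(2 + i)/(2 - i) = (u - iv)(3 + 4i)/5.\<close>
  define g :: "int \<times> int \<Rightarrow> int \<times> int" where "g = (\<lambda>(u, v).
    (sgn (3 * u + 4 * v) * ((3 * u + 4 * v) div 5), sgn (3 * u + 4 * v) * ((4 * u - 3 * v) div 5)))"
  have A: "\<exists>t. u = 2 * v + 5 * t \<and> 3 * u + 4 * v = 5 * (2 * v + 3 * t) \<and> 4 * u - 3 * v = 5 * (v + 4 * t)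
      \<and> even v \<and> odd t" if "(u, v) \<in> A" for u v
  proof -
    from that have "5 dvd u + 3 * v" by (simp add: A_def)
    hence "5 dvd (u + 3 * v) - 5 * v" by (intro dvd_diff) auto
    then obtain t where "u + 3 * v - 5 * v = 5 * t" by (elim dvdE)
    hence t: "u = 2 * v + 5 * t" by simp
    have "even v" "odd u" using that assms odd_sum_two_squares[of u v M] by (auto simp: A_def)
    with t show ?thesis by (intro exI[of _ t]) auto
  qed
  have g: "\<exists>e t. (e = 1 \<or> e = -1) \<and> u = 2 * v + 5 * t \<and> g (u, v) = (e * (2 * v + 3 * t), e * (v + 4 * t)) \<and>
      e * (2 * v + 3 * t) > 0 \<and> even v \<and> odd t"
    if uv: "(u, v) \<in> A" for u v
  proof -
    from A[OF uv] obtain t where t: "u = 2 * v + 5 * t" "3 * u + 4 * v = 5 * (2 * v + 3 * t)"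
       "4 * u - 3 * v = 5 * (v + 4 * t)" "even v" "odd t"
      by blast
    define w where "w = 2 * v + 3 * t"
    \<comment> \<open>\<open>w\<close> is odd, so the sign used in \<open>g\<close> is never
      0.\<close>
    have w: "w \<noteq> 0" using t(4,5) unfolding w_def by presburger
    have g: "g (u, v) = (sgn w * w, sgn w * (v + 4 * t))"
      unfolding g_def prod.case t(2,3) w_def[symmetric] by (simp add: sgn_mult)
    have "sgn w = 1 \<or> sgn w = -1" "sgn w * w > 0" using w by (auto simp: sgn_if)
    with g t(1,4,5) show ?thesis unfolding w_def by blast
  qed
  have "finite A"
    by (rule finite_subset[OF _ finite_sum_two_squares[of M]]) (auto simp: A_def)
  hence "even (card A) \<longleftrightarrow> even (card {x\<in>A. g x = x})"
  proof (rule card_involution_parity)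
    fix x assume x: "x \<in> A"
    obtain u v where uv: "x = (u, v)" by fastforce
    from g[of u v] x uv obtain e t where e: "e = 1 \<or> e = -1" and u: "u = 2 * v + 5 * t"
      and gx: "g x = (e * (2 * v + 3 * t), e * (v + 4 * t))"
      and pos: "e * (2 * v + 3 * t) > 0" and par: "even v" "odd t" by auto
    have u_pos: "u > 0" and M: "u ^ 2 + v ^ 2 = M" using x uv by (auto simp: A_def)
    have "(e * (2 * v + 3 * t)) ^ 2 + (e * (v + 4 * t)) ^ 2 = M"
      using e M u by (auto simp: power2_eq_square algebra_simps)
    moreover have "odd (e * (2 * v + 3 * t))" using e par by auto
    moreover have "e * (2 * v + 3 * t) + 3 * (e * (v + 4 * t)) = 5 * (e * (v + 3 * t))"
      by (simp add: algebra_simps)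
    ultimately show gA: "g x \<in> A"
      using pos unfolding gx A_def by simp
    show "g (g x) = x"
    proof -
      have "3 * (e * (2 * v + 3 * t)) + 4 * (e * (v + 4 * t)) = 5 * (e * u)"
        "4 * (e * (2 * v + 3 * t)) - 3 * (e * (v + 4 * t)) = 5 * (e * v)"
        by (simp_all add: u algebra_simps)
      hence "g (g x) = (sgn (5 * (e * u)) * (e * u), sgn (5 * (e * u)) * (e * v))"
        unfolding gx by (simp add: g_def)
      thus ?thesis using e u_pos uv by (auto simp: sgn_mult)
    qed
  qed
  moreover have "{x\<in>A. g x = x} = {(u, v). v = - 2 * u \<and> 5 * u ^ 2 = M \<and> u > 0}"
  proof (intro set_eqI iffI)
    fix x assume x: "x \<in> {x\<in>A. g x = x}"
    obtain u v where uv: "x = (u, v)" by fastforce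
    have uvA: "(u, v) \<in> A" using x uv by simp
    from g[OF uvA] obtain e t where e: "e = 1 \<or> e = -1" and u: "u = 2 * v + 5 * t"
      and gx: "g (u, v) = (e * (2 * v + 3 * t), e * (v + 4 * t))" and par: "even v" "odd t"
      by blast
    \<comment> \<open>The case e = 1 forces t = 0, against \<open>odd t\<close>; the case e = -1
      gives v = -2 t and u = t.\<close>
    have "v = - 2 * u" using e gx x uv u par by auto
    with x uv show "x \<in> {(u, v). v = - 2 * u \<and> 5 * u ^ 2 = M \<and> u > 0}"
      by (auto simp: A_def power2_eq_square)
  next
    fix x assume x: "x \<in> {(u, v). v = - 2 * u \<and> 5 * u ^ 2 = M \<and> u > 0}"
    then obtain u where u: "x = (u, - 2 * u)" "5 * u ^ 2 = M" "u > 0" by auto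
    have "odd u" using assms u(2) by auto
    with u show "x \<in> {x\<in>A. g x = x}"
      by (auto simp: A_def g_def power2_eq_square sgn_mult)
  qed
  moreover have "card {(u, v). v = - 2 * u \<and> 5 * u ^ 2 = M \<and> u > 0} = of_bool (\<exists>s. 5 * s ^ 2 = M)"
  proof (cases "\<exists>s. 5 * s ^ 2 = M")
    case True
    then obtain s where s: "5 * s ^ 2 = M" by blast
    have "s \<noteq> 0" using s assms by auto
    hence "{(u, v). v = - 2 * u \<and> 5 * u ^ 2 = M \<and> u > 0} = {(\<bar>s\<bar>, - 2 * \<bar>s\<bar>)}"
      using s[symmetric] by (auto simp: power2_eq_iff)
    thus ?thesis using True by simp
  next
    case False
    hence "{(u, v). v = - 2 * u \<and> 5 * u ^ 2 = M \<and> u > 0} = {}" by auto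
    thus ?thesis using False by simp
  qed
  ultimately show ?thesis by (simp add: A_def)
qed

text \<open>Rotation by i multiplies u + 3v by 3 modulo 5, a generator of the nonzero classes, so
  \<open>T\<close> is spread evenly over them. The pairs correspond to class 2, a quarter of
  \<open>T\<close>; so do the points with u odd and positive, and these number
  \<open>card ?R - card ?R5\<close>.\<close>

lemma card_theta_pairs_parity:
  "even (card {(x, y). theta_exponent 1 4 x + theta_exponent 2 3 y = int m}) \<longleftrightarrow>
    ((\<exists>s::int. s ^ 2 = 4 * int m + 1) \<longleftrightarrow> (\<exists>s::int. 5 * s ^ 2 = 4 * int m + 1))"
proof -
  define M where "M = 4 * int m + 1"
  have M: "odd M" by (simp add: M_def)
  define T where "T = {(u, v). u ^ 2 + v ^ 2 = M \<and> \<not> 5 dvd u + 3 * v}"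
  define r :: "int \<times> int \<Rightarrow> int \<times> int" where "r = (\<lambda>(u, v). (- v, u))"
  let ?P = "\<lambda>(u, v). 5 dvd u + 3 * v + (3::int)"
  let ?Q = "\<lambda>(u, v). odd u \<and> u > (0::int)"
  let ?R = "{(u, v). u ^ 2 + v ^ 2 = M \<and> odd u \<and> u > 0}"
  let ?R5 = "{(u, v). u ^ 2 + v ^ 2 = M \<and> odd u \<and> u > 0 \<and> 5 dvd u + 3 * v}"
  have parity: "odd u \<longleftrightarrow> even v" if "(u, v) \<in> T" for u v
    using that M odd_sum_two_squares[of u v M] by (auto simp: T_def)
  have finT: "finite T"
    by (rule finite_subset[OF _ finite_sum_two_squares[of M]]) (auto simp: T_def)
  have inj: "inj_on r T" by (auto simp: inj_on_def r_def)
  have rT: "r x \<in> T" if "x \<in> T" for x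
  proof -
    obtain u v where x: "x = (u, v)" by fastforce
    have "\<not> 5 dvd - v + 3 * u" if "\<not> 5 dvd u + 3 * v" using that by presburger
    with that show ?thesis by (auto simp: x T_def r_def add.commute)
  qed
  have im: "r ` T = T"
    using finT inj rT by (metis card_image card_subset_eq image_subsetI)
  \<comment> \<open>(10x - 3) + i(10y - 1) has norm 10(4m + 1); the substitution divides it by 1 - 3i.\<close>
  have "bij_betw (\<lambda>(x, y). (x - 3 * y, 3 * x + y - 1))
      {(x, y). theta_exponent 1 4 x + theta_exponent 2 3 y = int m} {x\<in>T. ?P x}"
  proof (rule bij_betw_byWitness[where f' = "\<lambda>(u, v). ((u + 3 * v + 3) div 10, (v + 1 - 3 * u) div 10)"])
    have form: "theta_exponent 1 4 x + theta_exponent 2 3 y = int m \<longleftrightarrow>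
      (x - 3 * y) ^ 2 + (3 * x + y - 1) ^ 2 = M" for x y
      using theta_exponent_doubled[of 1 4 x] theta_exponent_doubled[of 2 3 y]
      unfolding M_def by (auto simp: power2_eq_square algebra_simps)
    \<comment> \<open>The class modulo 5 and the opposite parities of u and v make the first
      expression a multiple of 10; the second is 10 (v + 1) - 3 (u + 3v + 3).\<close>
    have ten: "\<exists>x y. u + 3 * v + 3 = 10 * x \<and> v + 1 - 3 * u = 10 * y"
      if uv: "(u, v) \<in> {x\<in>T. ?P x}" for u v
    proof -
      have "5 dvd u + 3 * v + 3" "odd u \<longleftrightarrow> even v" using uv parity[of u v] by auto
      then obtain k where k: "u + 3 * v + 3 = 5 * k" by (elim dvdE)
      have "even (u + 3 * v + 3)" using \<open>odd u \<longleftrightarrow> even v\<close> by auto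
      hence "even k" unfolding k by simp
      then obtain l where "k = 2 * l" by (elim evenE)
      with k have "u + 3 * v + 3 = 10 * l" "v + 1 - 3 * u = 10 * (1 + v - 3 * l)"
        by simp_all
      thus ?thesis by blast
    qed
    show "\<forall>a\<in>{(x, y). theta_exponent 1 4 x + theta_exponent 2 3 y = int m}.
      (\<lambda>(u, v). ((u + 3 * v + 3) div 10, (v + 1 - 3 * u) div 10)) ((\<lambda>(x, y). (x - 3 * y, 3 * x + y - 1)) a) = a"
      by (auto simp: algebra_simps)
    show "\<forall>a'\<in>{x\<in>T. ?P x}. (\<lambda>(x, y). (x - 3 * y, 3 * x + y - 1))
      ((\<lambda>(u, v). ((u + 3 * v + 3) div 10, (v + 1 - 3 * u) div 10)) a') = a'"
    proof
      fix z assume z: "z \<in> {x\<in>T. ?P x}"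
      obtain u v where uv: "z = (u, v)" by fastforce
      from ten z uv obtain x y where "u + 3 * v + 3 = 10 * x" "v + 1 - 3 * u = 10 * y" by blast
      thus "(\<lambda>(x, y). (x - 3 * y, 3 * x + y - 1))
        ((\<lambda>(u, v). ((u + 3 * v + 3) div 10, (v + 1 - 3 * u) div 10)) z) = z"
        unfolding uv by simp
    qed
    show "(\<lambda>(x, y). (x - 3 * y, 3 * x + y - 1)) `
      {(x, y). theta_exponent 1 4 x + theta_exponent 2 3 y = int m} \<subseteq> {x\<in>T. ?P x}"
    proof (intro image_subsetI)
      fix z assume z: "z \<in> {(x, y). theta_exponent 1 4 x + theta_exponent 2 3 y = int m}"
      obtain x y where xy: "z = (x, y)" by fastforce
      have "(x - 3 * y) ^ 2 + (3 * x + y - 1) ^ 2 = M" using form z xy by auto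
      moreover have "\<not> 5 dvd (x - 3 * y) + 3 * (3 * x + y - 1)" by presburger
      moreover have "5 dvd (x - 3 * y) + 3 * (3 * x + y - 1) + 3" by presburger
      ultimately show "(\<lambda>(x, y). (x - 3 * y, 3 * x + y - 1)) z \<in> {x\<in>T. ?P x}"
        by (simp add: xy T_def)
    qed
    show "(\<lambda>(u, v). ((u + 3 * v + 3) div 10, (v + 1 - 3 * u) div 10)) ` {x\<in>T. ?P x} \<subseteq>
      {(x, y). theta_exponent 1 4 x + theta_exponent 2 3 y = int m}"
    proof (intro image_subsetI)
      fix z assume z: "z \<in> {x\<in>T. ?P x}"
      obtain u v where uv: "z = (u, v)" by fastforce
      from ten z uv obtain x y where xy: "u + 3 * v + 3 = 10 * x" "v + 1 - 3 * u = 10 * y" by blast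
      hence "u = x - 3 * y" "v = 3 * x + y - 1" by simp_all
      with z uv form[of x y] xy
      show "(\<lambda>(u, v). ((u + 3 * v + 3) div 10, (v + 1 - 3 * u) div 10)) z \<in>
        {(x, y). theta_exponent 1 4 x + theta_exponent 2 3 y = int m}"
        by (auto simp: T_def)
    qed
  qed
  hence "card {(x, y). theta_exponent 1 4 x + theta_exponent 2 3 y = int m} = card {x\<in>T. ?P x}"
    by (rule bij_betw_same_card)
  also have "\<dots> = card {x\<in>T. ?Q x}"
  proof -
    have "card T = 4 * card {x\<in>T. ?P x}"
    proof (rule card_four_cycle[OF finT inj im])
      fix x assume x: "x \<in> T"
      obtain u v where uv: "x = (u, v)" by fastforce
      \<comment> \<open>The four conditions along the orbit amount to a = 2, 4, 3, 1 in
        turn.\<close>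
      define a w where "a = (u + 3 * v) mod 5" and "w = (u + 3 * v) div 5"
      have u: "u = 5 * w + a - 3 * v"
        using mult_div_mod_eq[of 5 "u + 3 * v"] unfolding a_def w_def by linarith
      have eq: "u + 3 * v + 3 = 5 * w + (a + 3)" "- v + 3 * u + 3 = 5 * (3 * w - 2 * v) + (3 * a + 3)"
        "- u + 3 * - v + 3 = 5 * (- w) + (3 - a)" "v + 3 * - u + 3 = 5 * (2 * v - 3 * w) + (3 - 3 * a)"
        by (simp_all add: u)
      have five: "5 dvd 5 * y + c \<longleftrightarrow> 5 dvd c" for y c :: int
        by (rule dvd_add_right_iff) simp
      have "a \<noteq> 0" using x uv unfolding a_def by (auto simp: T_def dvd_eq_mod_eq_0)
      moreover have "0 \<le> a" "a < 5" by (simp_all add: a_def)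
      ultimately consider "a = 1" | "a = 2" | "a = 3" | "a = 4" by linarith
      hence "of_bool (5 dvd u + 3 * v + 3) + of_bool (5 dvd - v + 3 * u + 3) +
          of_bool (5 dvd - u + 3 * - v + 3) + of_bool (5 dvd v + 3 * - u + 3) = (1 :: nat)"
        unfolding eq five by cases simp_all
      thus "of_bool (?P x) + of_bool (?P (r x)) + of_bool (?P (r (r x))) + of_bool (?P (r (r (r x)))) = (1 :: nat)"
        by (simp only: uv r_def prod.case minus_minus)
    qed
    moreover have "card T = 4 * card {x\<in>T. ?Q x}"
    proof (rule card_four_cycle[OF finT inj im])
      fix x assume x: "x \<in> T"
      obtain u v where uv: "x = (u, v)" by fastforce
      \<comment> \<open>The first coordinates along the orbit are u, -v, -u, v, and exactly one of u
        and v is odd.\<close>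
      from parity x uv have "odd u \<longleftrightarrow> even v" by simp
      thus "of_bool (?Q x) + of_bool (?Q (r x)) + of_bool (?Q (r (r x))) + of_bool (?Q (r (r (r x)))) = (1 :: nat)"
        unfolding uv r_def prod.case of_bool_def by presburger
    qed
    ultimately show ?thesis by simp
  qed
  also have "{x\<in>T. ?Q x} = ?R - ?R5" by (auto simp: T_def)
  also have "card \<dots> = card ?R - card ?R5"
    by (rule card_Diff_subset)
       (auto intro: finite_subset[OF _ finite_sum_two_squares[of M]])
  finally have card: "card {(x, y). theta_exponent 1 4 x + theta_exponent 2 3 y = int m} =
    card ?R - card ?R5" .
  have "card ?R5 \<le> card ?R"
    by (rule card_mono) (auto intro: finite_subset[OF _ finite_sum_two_squares[of M]])
  thus ?thesis
    unfolding card M_def[symmetric]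
    using card_odd_positive_parity[OF M] card_odd_positive_5_parity[OF M] by (simp add: even_diff_nat) blast
qed

subsection \<open>Dissection of the eta quotient modulo 2\<close>

lemma euler_1_mult_euler_5_nth:
  "fps_nth (euler 1 * euler 5 :: bit fps) m =
    of_bool (\<exists>s::int. s ^ 2 = 4 * int m + 1) + of_bool (\<exists>s::int. 5 * s ^ 2 = 4 * int m + 1)"
  (is "_ = of_bool ?P + of_bool ?Q")
proof -
  have "fps_nth (euler 1 * euler 5 :: bit fps) m =
    of_nat (card {(x, y). theta_exponent 1 4 x + theta_exponent 2 3 y = int m})"
    unfolding euler_1_mult_euler_5 by (rule theta_mult_nth) auto
  also have "\<dots> = of_nat (of_bool ?P + of_bool ?Q)"
    unfolding of_nat_bit_eq_iff card_theta_pairs_parity by simp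
  finally show ?thesis by (simp only: of_nat_add of_nat_of_bool)
qed

text \<open>The two indicators in \<open>euler_1_mult_euler_5_nth\<close> are the coefficients of
  squared theta series, hence of sixth powers by \<open>euler_cubed\<close>. For d = 5 the factor
  \<open>fps_X\<close> turns 4 k + 5 into 4 m + 1.\<close>

lemma euler_1_mult_euler_5_eq:
  "euler 1 * euler 5 = (euler 1 ^ 6 + fps_X * euler 5 ^ 6 :: bit fps)"
proof (rule fps_ext)
  fix m
  have six: "euler d ^ 6 = (theta d (3 * d) ^ 2 :: bit fps)" if "d > 0" for d
    unfolding euler_cubed[OF that, symmetric] by (simp flip: power_mult)
  have "fps_nth (fps_X * euler 5 ^ 6 :: bit fps) m = of_bool (\<exists>s::int. 5 * s ^ 2 = 4 * int m + 1)"
  proof (cases m)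
    case 0
    have "5 * s ^ 2 \<noteq> (1::int)" for s by presburger
    thus ?thesis using 0 by simp
  next
    case (Suc k)
    thus ?thesis
      using theta_3_power2_nth[of 5 k] six[of 5] by (simp add: algebra_simps)
  qed
  moreover have "fps_nth (euler 1 ^ 6 :: bit fps) m = of_bool (\<exists>s::int. s ^ 2 = 4 * int m + 1)"
    using theta_3_power2_nth[of 1 m] six[of 1] by simp
  ultimately show "fps_nth (euler 1 * euler 5 :: bit fps) m =
      fps_nth (euler 1 ^ 6 + fps_X * euler 5 ^ 6 :: bit fps) m"
    by (simp only: fps_add_nth euler_1_mult_euler_5_nth)
qed

text \<open>A square over \<open>bit\<close> lives on even indices, so each use of \<open>AB\<close>
  separates even from odd coefficients: index 4 t + 2 leads to 2 t + 1 in A^3 / B^3, and that to t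
  in A B.\<close>

lemma j10_series_bit_nth:
  "fps_nth (euler 2 * euler 5 ^ 5 * inverse (euler 1 * euler 10 ^ 5) :: bit fps) (4 * t + 2) =
    fps_nth (euler 1 * euler 5) t"
proof -
  define A B :: "bit fps" where "A = euler 1" and "B = euler 5"
  define I where "I = inverse B"
  have A2: "euler 2 = A ^ 2" and B2: "euler 10 = B ^ 2"
    using euler_double[of 1] euler_double[of 5] by (simp_all add: A_def B_def)
  have BI: "B * I = 1"
    unfolding I_def by (rule inverse_mult_eq_1') (simp add: B_def)
  have BI_power: "B ^ k * I ^ k = 1" for k
    unfolding power_mult_distrib[symmetric] BI by simp
  have AB: "A * B = A ^ 6 + fps_X * B ^ 6"
    using euler_1_mult_euler_5_eq by (simp only: A_def B_def)
  have "inverse (euler 1 * euler 10 ^ 5) = inverse A * I ^ 10"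
    unfolding B2 A_def[symmetric] I_def
    by (simp add: fps_inverse_mult fps_inverse_power flip: power_mult)
  hence "euler 2 * euler 5 ^ 5 * inverse (euler 1 * euler 10 ^ 5) =
      A ^ 2 * B ^ 5 * (inverse A * I ^ 10)"
    unfolding A2 B_def[symmetric] by simp
  also have "\<dots> = A * (A * inverse A) * (B ^ 5 * I ^ 5) * I ^ 5"
    by (simp add: eval_nat_numeral mult_ac)
  also have "A * inverse A = 1"
    by (rule inverse_mult_eq_1') (simp add: A_def)
  \<comment> \<open>A factor B I = 1 is inserted to produce \<open>A * B\<close>.\<close>
  also have "A * 1 * (B ^ 5 * I ^ 5) * I ^ 5 = (A * B) * I ^ 6"
    unfolding BI_power using BI by (simp add: eval_nat_numeral mult_ac)
  also have "\<dots> = (A ^ 3 * I ^ 3) ^ 2 + fps_X * (B ^ 6 * I ^ 6)"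
    unfolding AB by (simp add: algebra_simps flip: power_mult)
  \<comment> \<open>The other summand is just \<open>fps_X\<close>, which has no coefficient at 4 t
    + 2.\<close>
  finally have "fps_nth (euler 2 * euler 5 ^ 5 * inverse (euler 1 * euler 10 ^ 5) :: bit fps) (4 * t + 2) =
      fps_nth ((A ^ 3 * I ^ 3) ^ 2) (4 * t + 2)"
    unfolding BI_power by simp
  also have "\<dots> = fps_nth (A ^ 3 * I ^ 3) (2 * t + 1)"
    unfolding fps_power2_nth_bit by (simp add: algebra_simps)
  also have "A ^ 3 * I ^ 3 = (A * B) * (A ^ 2 * I ^ 4)"
    using BI by (simp add: eval_nat_numeral mult_ac)
  also have "\<dots> = (A ^ 4 * I ^ 2) ^ 2 + fps_X * ((A * B) ^ 2 * (B ^ 4 * I ^ 4))"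
    unfolding distrib_right by (subst AB) (simp add: eval_nat_numeral algebra_simps)
  finally show ?thesis
    unfolding BI_power by (simp add: fps_power2_nth_bit A_def B_def)
qed

text \<open>Both series are images of one integer series. A relation is used because there is no
  ring homomorphism from \<open>rat\<close> to \<open>bit\<close>.\<close>

definition fps_reduces :: "'a::ring_1 fps \<Rightarrow> 'b::ring_1 fps \<Rightarrow> bool" where
  "fps_reduces f g \<longleftrightarrow> (\<forall>n. \<exists>m. fps_nth f n = of_int m \<and> fps_nth g n = of_int m)"

lemma fps_reduces_diff: "fps_reduces f g \<Longrightarrow> fps_reduces f' g' \<Longrightarrow> fps_reduces (f - f') (g - g')"
  unfolding fps_reduces_def fps_sub_nth by (metis of_int_diff)

lemma sum_reduces:
  assumes "\<And>i. i \<in> A \<Longrightarrow> \<exists>m. f i = of_int m \<and> g i = of_int m"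
  shows "\<exists>m. sum f A = of_int m \<and> sum g A = of_int m"
proof -
  from assms obtain h where "\<forall>i\<in>A. f i = of_int (h i) \<and> g i = of_int (h i)" by metis
  thus ?thesis by (intro exI[of _ "sum h A"]) simp
qed

lemma fps_reduces_mult:
  assumes "fps_reduces f g" "fps_reduces f' g'"
  shows "fps_reduces (f * f') (g * g')"
  unfolding fps_reduces_def fps_mult_nth
proof (intro allI sum_reduces)
  fix n i
  from assms obtain k l where "fps_nth f i = of_int k \<and> fps_nth g i = of_int k"
      "fps_nth f' (n - i) = of_int l \<and> fps_nth g' (n - i) = of_int l"
    unfolding fps_reduces_def by metis
  thus "\<exists>m. fps_nth f i * fps_nth f' (n - i) = of_int m \<and> fps_nth g i * fps_nth g' (n - i) = of_int m"
    by (intro exI[of _ "k * l"]) simp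
qed

lemma fps_reduces_1: "fps_reduces 1 1"
  unfolding fps_reduces_def by (auto intro: exI[of _ 0] exI[of _ 1])

lemma fps_reduces_X_power: "fps_reduces (fps_X ^ k) (fps_X ^ k)"
  unfolding fps_reduces_def fps_X_power_nth by (auto intro: exI[of _ 0] exI[of _ 1])

lemma fps_reduces_power: "fps_reduces f g \<Longrightarrow> fps_reduces (f ^ k) (g ^ k)"
  by (induction k) (auto intro: fps_reduces_1 fps_reduces_mult)

lemma fps_reduces_euler:
  "fps_reduces (euler m :: 'a::comm_ring_1 fps) (euler m :: 'b::comm_ring_1 fps)"
proof -
  have "fps_reduces (euler_poly m N :: 'a fps) (euler_poly m N :: 'b fps)" for N
    unfolding euler_poly_def
    by (induction N) (auto intro!: fps_reduces_1 fps_reduces_mult fps_reduces_diff fps_reduces_X_power)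
  thus ?thesis by (simp add: fps_reduces_def euler_def)
qed

text \<open>With constant term 1 the coefficients of the inverse satisfy a recursion without
  division, so they stay integral.\<close>

lemma fps_reduces_inverse:
  fixes f :: "'a::field fps" and g :: "'b::field fps"
  assumes "fps_reduces f g" "fps_nth f 0 = 1" "fps_nth g 0 = 1"
  shows "fps_reduces (inverse f) (inverse g)"
  unfolding fps_reduces_def
proof
  have rec: "fps_nth (inverse h) n = - (\<Sum>i=1..n. fps_nth h i * fps_nth (inverse h) (n - i))"
    if "n > 0" "fps_nth h 0 = 1" for n and h :: "'c::field fps"
  proof -
    have "0 = fps_nth (h * inverse h) n" using that by (subst inverse_mult_eq_1') auto
    also have "\<dots> = fps_nth (inverse h) n + (\<Sum>i=1..n. fps_nth h i * fps_nth (inverse h) (n - i))"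
      using that(2) by (simp add: fps_mult_nth sum.atLeast_Suc_atMost)
    finally show ?thesis by (simp add: eq_neg_iff_add_eq_0)
  qed
  fix n
  show "\<exists>m. fps_nth (inverse f) n = of_int m \<and> fps_nth (inverse g) n = of_int m"
  proof (induction n rule: less_induct)
    case (less n)
    show ?case
    proof (cases "n = 0")
      case True
      thus ?thesis using assms by (intro exI[of _ 1]) simp
    next
      case False
      have "\<exists>m. (\<Sum>i=1..n. fps_nth f i * fps_nth (inverse f) (n - i)) = of_int m \<and>
        (\<Sum>i=1..n. fps_nth g i * fps_nth (inverse g) (n - i)) = of_int m"
      proof (rule sum_reduces)
        fix i assume "i \<in> {1..n}"
        then obtain k l where "fps_nth f i = of_int k \<and> fps_nth g i = of_int k"
          "fps_nth (inverse f) (n - i) = of_int l \<and> fps_nth (inverse g) (n - i) = of_int l"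
          using assms(1) less[of "n - i"] unfolding fps_reduces_def by fastforce
        thus "\<exists>m. fps_nth f i * fps_nth (inverse f) (n - i) = of_int m \<and>
            fps_nth g i * fps_nth (inverse g) (n - i) = of_int m"
          by (intro exI[of _ "k * l"]) simp
      qed
      then obtain m where "(\<Sum>i=1..n. fps_nth f i * fps_nth (inverse f) (n - i)) = of_int m"
        "(\<Sum>i=1..n. fps_nth g i * fps_nth (inverse g) (n - i)) = of_int m" by blast
      with False rec[of n f] rec[of n g] assms(2,3) show ?thesis
        by (intro exI[of _ "- m"]) simp
    qed
  qed
qed

section \<open>Parity of the coefficients \<open>J10\<close>\<close>

lemma of_int_bit_eq_0_iff: "(of_int m :: bit) = 0 \<longleftrightarrow> even m"
proof (cases m)
  case (nonneg n)
  thus ?thesis using of_nat_bit_eq_iff[of n 0] by simp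
next
  case (neg n)
  thus ?thesis using of_nat_bit_eq_iff[of "Suc n" 0] by (simp only: of_int_minus of_int_of_nat_eq neg_equal_0_iff_equal) simp
qed

text \<open>\<open>J10\<close> at 4 t + 1 is the coefficient of \<open>j10_series\<close> at 4 t +
  2, away from the correction at index 0. Its image in \<open>bit\<close> is the sum of the two
  indicators, both 0 here.\<close>

lemma J10_even:
  assumes "\<not> (\<exists>s::int. s ^ 2 = 4 * int t + 1)" "\<not> (\<exists>s::int. 5 * s ^ 2 = 4 * int t + 1)"
  shows "\<exists>m. J10 (4 * t + 1) = of_int (2 * m)"
proof -
  have "fps_reduces j10_series
    (euler 2 * euler 5 ^ 5 * inverse (euler 1 * euler 10 ^ 5) :: bit fps)"
    unfolding j10_series_def euler_fps_eq_euler
    by (intro fps_reduces_mult fps_reduces_power fps_reduces_euler fps_reduces_inverse)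
       (simp_all add: fps_nth_power_0)
  then obtain m where m: "fps_nth j10_series (4 * t + 2) = of_int m"
    "fps_nth (euler 2 * euler 5 ^ 5 * inverse (euler 1 * euler 10 ^ 5) :: bit fps) (4 * t + 2) = of_int m"
    unfolding fps_reduces_def by blast
  have "(of_int m :: bit) = 0"
    using m(2) assms unfolding j10_series_bit_nth euler_1_mult_euler_5_nth by simp
  hence "even m" by (simp only: of_int_bit_eq_0_iff)
  with m(1) show ?thesis by (auto simp: J10_def elim!: evenE)
qed

section \<open>Arithmetic of the index\<close>

theorem theorem4p2:
  fixes k n :: nat and p :: "nat \<Rightarrow> nat" and j :: int
  assumes primes: "\<And>i. i \<in> {1..k+1} \<Longrightarrow> prime (p i)"
    and mod4: "\<And>i. i \<in> {1..k+1} \<Longrightarrow> p i mod 4 = 3"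
    and ndvd: "\<not> int (p (k+1)) dvd j"
    and nonneg: "4 * int (p (k+1)) * int n + 4 * j + int (p (k+1)) \<ge> 0"
  shows "\<exists>m::int. J10 (nat ((\<Prod>i\<in>{1..k}. int (p i) ^ 2) * int (p (k+1))
                  * (4 * int (p (k+1)) * int n + 4 * j + int (p (k+1)))))
              = of_int (2 * m)"
proof -
  define q where "q = int (p (k + 1))"
  define Q where "Q = (\<Prod>i\<in>{1..k}. int (p i))"
  define w where "w = 4 * q * int n + 4 * j + q"
  define N where "N = Q ^ 2 * q * w"
  have q: "prime q" and q4: "q mod 4 = 3"
    using primes[of "k + 1"] mod4[of "k + 1"] zmod_int[of "p (k + 1)" 4] by (auto simp: q_def)
  have w0: "w \<ge> 0" using nonneg by (simp add: w_def q_def)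
  have q2: "coprime q 4"
  proof -
    have "odd q" using q4 by presburger
    have "(4::int) = 2 * 2" by simp
    with \<open>odd q\<close> show ?thesis by (simp only: coprime_mult_right_iff coprime_right_2_iff_odd simp_thms not_False_eq_True)
  qed
  have ndvd_w: "\<not> q dvd w"
  proof
    assume "q dvd w"
    \<comment> \<open>Modulo \<open>q\<close>, \<open>w\<close> is 4 j, and 4 is coprime to the odd
      prime \<open>q\<close>.\<close>
    hence "q dvd w - q * (4 * int n + 1)" by (intro dvd_diff) auto
    also have "w - q * (4 * int n + 1) = 4 * j" by (simp add: w_def algebra_simps)
    finally have "q dvd j" using q2 by (simp add: coprime_dvd_mult_right_iff)
    with ndvd show False by (simp add: q_def)
  qed
  have Q0: "Q \<noteq> 0" and oddQ: "odd Q"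
  proof -
    have "odd (int (p i))" if "i \<in> {1..k}" for i
      using mod4[of i] that by simp presburger
    thus "odd Q" by (auto simp: Q_def even_prod_iff)
    thus "Q \<noteq> 0" by auto
  qed
  have nz: "q \<noteq> 0" "w \<noteq> 0" using q ndvd_w by auto
  \<comment> \<open>The square of the odd \<open>Q\<close> is 1 modulo 4, while \<open>q\<close> and
    \<open>w\<close> are both 3.\<close>
  have N_mod: "N mod 4 = 1"
  proof -
    obtain s where "Q = 2 * s + 1" using oddQ by (elim oddE)
    hence "Q ^ 2 = 4 * (s * s + s) + 1" by (simp add: power2_eq_square algebra_simps)
    hence Q4: "Q ^ 2 mod 4 = 1" by presburger
    have "w = q + 4 * (q * int n + j)" by (simp add: w_def algebra_simps)
    hence "w mod 4 = 3" using q4 by (simp only: mod_mult_self2)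
    hence "q * w mod 4 = 1" using q4 mod_mult_eq[of q 4 w] by simp
    thus ?thesis using Q4 mod_mult_eq[of "Q ^ 2" 4 "q * w"] by (simp add: N_def mult.assoc)
  qed
  have N0: "N \<ge> 0" using w0 by (simp add: N_def q_def)
  define t where "t = nat (N div 4)"
  have t: "4 * int t + 1 = N"
    using N_mod N0 mult_div_mod_eq[of 4 N] by (simp add: t_def)
  have pe: "prime_elem q" using q by (rule prime_imp_prime_elem)
  \<comment> \<open>\<open>Q ^ 2\<close> contributes an even amount, even when \<open>q\<close>
    occurs in it; the single factor \<open>q\<close> adds one and \<open>w\<close> nothing.\<close>
  have odd_mult: "odd (multiplicity q N)"
  proof -
    have "multiplicity q N = 2 * multiplicity q Q + multiplicity q q + multiplicity q w"
      using pe Q0 nz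
      by (simp add: N_def prime_elem_multiplicity_mult_distrib prime_elem_multiplicity_power_distrib)
    also have "multiplicity q w = 0" using ndvd_w by (rule not_dvd_imp_multiplicity_0)
    also have "multiplicity q q = 1"
      using q by (intro multiplicity_self) auto
    finally show ?thesis by simp
  qed
  have sq: "s ^ 2 \<noteq> N" for s
  proof
    assume s: "s ^ 2 = N"
    hence "s \<noteq> 0" using N_mod by auto
    hence "multiplicity q N = 2 * multiplicity q s"
      using pe by (simp add: prime_elem_multiplicity_power_distrib flip: s)
    with odd_mult show False by simp
  qed
  have sq5: "5 * s ^ 2 \<noteq> N" for s
  proof
    assume s: "5 * s ^ 2 = N"
    hence s0: "s \<noteq> 0" using N_mod by auto
    \<comment> \<open>The only prime dividing 5 is 1 modulo 4, so the factor 5 leaves the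
      multiplicity of \<open>q\<close> even.\<close>
    have "\<not> q dvd 5"
    proof
      assume "q dvd 5"
      hence "q = 5" using q by (simp add: primes_dvd_imp_eq)
      with q4 show False by simp
    qed
    hence "multiplicity q 5 = 0" by (rule not_dvd_imp_multiplicity_0)
    hence "multiplicity q N = 2 * multiplicity q s"
      using pe s0 by (simp add: prime_elem_multiplicity_mult_distrib
          prime_elem_multiplicity_power_distrib flip: s)
    with odd_mult show False by simp
  qed
  have "nat N = 4 * t + 1" using t by linarith
  moreover have "\<exists>m. J10 (4 * t + 1) = of_int (2 * m)"
    by (rule J10_even) (use sq sq5 t in auto)
  ultimately have "\<exists>m. J10 (nat N) = of_int (2 * m)" by simp
  thus ?thesis
    by (simp only: N_def Q_def q_def w_def prod_power_distrib)
qed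

end
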